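(* Let $I=\langle q\rangle$ and $I'=\langle q'\rangle$ be two distinct circles at infinity, with $$q=\sum_{j=0}^{p}b_jz_\infty^{-\alpha_j/\beta},\qquad q'=\sum_{j=0}^{p'}b'_jz_\infty^{-\alpha'_j/\beta'},$$ where $\beta,\beta'$ are the ramification orders, all $b_j,b'_j$ are nonzero, $\alpha_0>\dots>\alpha_p$ and $\alpha'_0>\dots>\alpha'_{p'}$; put $\alpha=\alpha_0$, $\alpha'=\alpha'_0$. Let $r$ be the biggest integer such that $\sum_{j=0}^{r-1}b_jz_\infty^{-\alpha_j/\beta}$ and $\sum_{j=0}^{r-1}b'_jz_\infty^{-\alpha'_j/\beta'}$ have the same Galois orbit. Write $(\cdot,\dots,\cdot)$ for greatest common divisors. 1. Assume $\alpha_r/\beta\ge\alpha'_r/\beta'$. Then the number of edges between $I$ and $I'$ is $$\begin{aligned}B_{I,I'}=&(\beta'-(\alpha'_0,\beta'))\alpha_0+((\alpha'_0,\beta')-(\alpha'_0,\alpha'_1,\beta'))\alpha_1+\cdots\\&+((\alpha'_0,\dots,\alpha'_{r-2},\beta')-(\alpha'_0,\dots,\alpha'_{r-1},\beta'))\alpha_{r-1}+(\alpha'_0,\dots,\alpha'_{r-1},\beta')\alpha_r-\beta\beta'.\end{aligned}$$ 2. In particular, if $q$ and $q'$ have no common part (i.e. $r=0$) and $\alpha/\beta\ge\alpha'/\beta'$, then $B_{I,I'}=\beta'(\alpha-\beta)$.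
   Context: Let $z_\infty=1/z$. An exponential factor at infinity is a polynomial without constant term in $z_\infty^{-1/\beta}$ for some $\beta\ge1$; the smallest possible $\beta$ is its ramification order $\mathrm{ram}(q)$, and its degree in $z_\infty^{-1/\beta}$ is its irregularity $\mathrm{Irr}(q)$; its slope is $\mathrm{Irr}(q)/\mathrm{ram}(q)$ (slope of $0$ is $0$). Its Galois orbit is the set of its conjugates $q_i$ under $z_\infty^{1/\beta}\mapsto \omega z_\infty^{1/\beta}$, $\omega^\beta=1$, and the circle $\langle q\rangle$ is this orbit (a connected $\beta$-fold cover of the circle of directions at $\infty$). For distinct circles, the number of edges is defined as $$B_{I,I'}=\mathrm{Irr}(\mathrm{Hom}(I,I'))-\beta\beta',\qquad \mathrm{Irr}(\mathrm{Hom}(I,I'))=\sum_{i=0}^{\beta-1}\sum_{j=0}^{\beta'-1}\mathrm{slope}(q_i-q'_j),$$ the sum being over all pairs of Galois conjugates of $q$ and $q'$. Conventions: an index beyond the last term of a factor gives exponent $0$ (e.g. $\alpha'_r=0$ if $r=p'+1$; $\alpha'=0$ if $q'=0$); for $r=0$ the g.c.d. $(\alpha'_0,\dots,\alpha'_{r-1},\beta')$ is $\beta'$ and the preceding terms are absent. *)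

theory Defs
  imports Complex_Main "HOL-Library.Poly_Mapping" "HOL-Library.Real_Mod"
begin

text \<open>
  A finite sum of terms c z^e, with rational e and z the inverse of the coordinate z_\<infinity>, is
  represented by the finitely supported map sending the exponent e to the coefficient c.  So
  c z_\<infinity>^(-k/\<beta>) is Poly_Mapping.single (k/\<beta>) c, and sums and differences are those of
  the library.
\<close>

type_synonym puiseux = "rat \<Rightarrow>\<^sub>0 complex"

text \<open>The map is a polynomial without constant term in z_\<infinity>^(-1/\<beta>).\<close>

definition poly_in_root :: "nat \<Rightarrow> puiseux \<Rightarrow> bool" where
  "poly_in_root \<beta> q \<longleftrightarrow> (\<forall>e\<in>Poly_Mapping.keys q. \<exists>k::nat. k \<ge> 1 \<and> e = of_nat k / of_nat \<beta>)"

definition exp_factor :: "puiseux \<Rightarrow> bool" where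
  "exp_factor q \<longleftrightarrow> (\<exists>\<beta>\<ge>1. poly_in_root \<beta> q)"

definition ram :: "puiseux \<Rightarrow> nat" where
  "ram q = (LEAST \<beta>. \<beta> \<ge> 1 \<and> poly_in_root \<beta> q)"

text \<open>The degree in z_\<infinity>^(-1/ram q); the inserted 0 only matters for q = 0.\<close>

definition Irr :: "puiseux \<Rightarrow> nat" where
  "Irr q = Max (insert 0 {k. of_nat k / of_nat (ram q) \<in> Poly_Mapping.keys q})"

definition slope :: "puiseux \<Rightarrow> rat" where
  "slope q = of_nat (Irr q) / of_nat (ram q)"

text \<open>
  The substitution z_\<infinity>^(1/\<beta>) \<mapsto> \<omega> z_\<infinity>^(1/\<beta>), for q a polynomial in z_\<infinity>^(-1/\<beta>):
  the term with exponent e = k/\<beta> is multiplied by \<omega>^(-k), where k = \<beta> e is an integer (the floor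
  is only a conversion of types).
\<close>

definition root_subst :: "nat \<Rightarrow> complex \<Rightarrow> puiseux \<Rightarrow> puiseux" where
  "root_subst \<beta> \<omega> q = Poly_Mapping.mapp (\<lambda>e c. \<omega> powi (- \<lfloor>of_nat \<beta> * e\<rfloor>) * c) q"

definition circle :: "puiseux \<Rightarrow> puiseux set" where
  "circle q = {root_subst (ram q) \<omega> q | \<omega>. \<omega> ^ ram q = 1}"

definition conjugate :: "puiseux \<Rightarrow> nat \<Rightarrow> puiseux" where
  "conjugate q i = root_subst (ram q) (cis (2 * pi * real i / real (ram q))) q"

text \<open>
  The next two are written in terms of representatives; lemmas irr_Hom_eq_sum_circle and
  num_edges_cong below show that they only depend on the circles.
\<close>

definition irr_Hom :: "puiseux \<Rightarrow> puiseux \<Rightarrow> rat" where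
  "irr_Hom q q' = (\<Sum>i<ram q. \<Sum>j<ram q'. slope (conjugate q i - conjugate q' j))"

definition num_edges :: "puiseux \<Rightarrow> puiseux \<Rightarrow> rat" where
  "num_edges q q' = irr_Hom q q' - of_nat (ram q) * of_nat (ram q')"

definition puiseux_sum :: "(nat \<Rightarrow> complex) \<Rightarrow> (nat \<Rightarrow> nat) \<Rightarrow> nat \<Rightarrow> nat \<Rightarrow> puiseux" where
  "puiseux_sum b \<alpha> \<beta> m = (\<Sum>j<m. Poly_Mapping.single (of_nat (\<alpha> j) / of_nat \<beta>) (b j))"

text \<open>
  The expansion of q has n terms, indexed by 0, ..., n - 1 (so n = p + 1, and n = 0 for q = 0);
  exponents beyond the last term are 0 by convention.
\<close>

definition expansion :: "puiseux \<Rightarrow> nat \<Rightarrow> (nat \<Rightarrow> complex) \<Rightarrow> (nat \<Rightarrow> nat) \<Rightarrow> bool" where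
  "expansion q n b \<alpha> \<longleftrightarrow>
     q = puiseux_sum b \<alpha> (ram q) n \<and>
     (\<forall>j<n. b j \<noteq> 0) \<and>
     (\<forall>i j. i < j \<and> j < n \<longrightarrow> \<alpha> j < \<alpha> i) \<and>
     (\<forall>j\<ge>n. \<alpha> j = 0)"

text \<open>The g.c.d. of \<alpha> 0, ..., \<alpha> (m - 1) and \<beta>; it is \<beta> for m = 0.\<close>

definition gcd_upto :: "(nat \<Rightarrow> nat) \<Rightarrow> nat \<Rightarrow> nat \<Rightarrow> nat" where
  "gcd_upto \<alpha> \<beta> m = Gcd (insert \<beta> (\<alpha> ` {..<m}))"

lemma ram_props:
  assumes "exp_factor q"
  shows "ram q \<ge> 1" and "poly_in_root (ram q) q"
proof -
  have "ram q \<ge> 1 \<and> poly_in_root (ram q) q"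
    unfolding ram_def using assms by (intro LeastI_ex[where P = "\<lambda>\<beta>. \<beta> \<ge> 1 \<and> poly_in_root \<beta> q"]) (simp add: exp_factor_def)
  then show "ram q \<ge> 1" and "poly_in_root (ram q) q" by auto
qed

lemma lookup_root_subst:
  "Poly_Mapping.lookup (root_subst \<beta> \<omega> q) e = \<omega> powi (- \<lfloor>of_nat \<beta> * e\<rfloor>) * Poly_Mapping.lookup q e"
  by (auto simp: root_subst_def Poly_Mapping.lookup_mapp when_def in_keys_iff)

lemma circle_eq_conjugates:
  assumes "exp_factor q"
  shows "circle q = conjugate q ` {..<ram q}"
proof -
  have "bij_betw (\<lambda>k. cis (2 * pi * real k / real (ram q))) {..<ram q} {z. z ^ ram q = 1}"
    using ram_props(1)[OF assms] by (intro bij_betw_roots_unity) auto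
  then have *: "{z. z ^ ram q = 1} = (\<lambda>k. cis (2 * pi * real k / real (ram q))) ` {..<ram q}"
    by (simp add: bij_betw_def)
  have "circle q = (\<lambda>\<omega>. root_subst (ram q) \<omega> q) ` {z. z ^ ram q = 1}"
    by (auto simp: circle_def)
  then show ?thesis
    unfolding * image_image conjugate_def .
qed

lemma inj_on_conjugate:
  assumes q: "exp_factor q"
  shows "inj_on (conjugate q) {..<ram q}"
proof (rule linorder_inj_onI)
  fix i j assume ij: "i < j" "i \<in> {..<ram q}" "j \<in> {..<ram q}"
  define \<beta> where "\<beta> = ram q"
  have \<beta>: "\<beta> \<ge> 1" "poly_in_root \<beta> q"
    using ram_props[OF q] by (auto simp: \<beta>_def)
  show "conjugate q i \<noteq> conjugate q j"
  proof
    assume eq: "conjugate q i = conjugate q j"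
    define d where "d = gcd (j - i) \<beta>"
    have d: "d \<ge> 1" "d < \<beta>" "d dvd \<beta>"
    proof -
      show "d \<ge> 1" using \<beta> by (simp add: d_def Suc_le_eq)
      have "d \<le> j - i" using ij by (auto simp: d_def intro: dvd_imp_le)
      then show "d < \<beta>" using ij by (auto simp: \<beta>_def)
    qed (simp add: d_def)
    have "poly_in_root d q"
      unfolding poly_in_root_def
    proof
      fix e assume e: "e \<in> Poly_Mapping.keys q"
      then obtain k :: nat where k: "k \<ge> 1" "e = of_nat k / of_nat \<beta>"
        using \<beta>(2) by (auto simp: poly_in_root_def)
      have fl: "\<lfloor>of_nat \<beta> * e\<rfloor> = int k" using \<beta>(1) by (simp add: k)
      have "cis (2 * pi * real i / real \<beta>) powi (- int k) =
            cis (2 * pi * real j / real \<beta>) powi (- int k)"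
        using arg_cong[OF eq, of "\<lambda>p. Poly_Mapping.lookup p e"] e
        by (simp add: conjugate_def lookup_root_subst flip: \<beta>_def) (simp add: fl in_keys_iff)
      then have "cis (- real k * (2 * pi * real i / real \<beta>)) =
            cis (- real k * (2 * pi * real j / real \<beta>))"
        by (simp only: cis_power_int) simp
      then have "cis (- real k * (2 * pi * real i / real \<beta>)) /
            cis (- real k * (2 * pi * real j / real \<beta>)) = 1"
        by (simp only: divide_self cis_neq_zero not_False_eq_True)
      then have "cis (- real k * (2 * pi * real i / real \<beta>) - (- real k * (2 * pi * real j / real \<beta>))) = 1"
        by (simp only: cis_divide)
      then obtain n where n: "- real k * (2 * pi * real i / real \<beta>) - (- real k * (2 * pi * real j / real \<beta>))
          = of_int n * (2 * pi)"
        unfolding cis_eq_1_iff by auto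
      have "real k * (real j - real i) * (2 * pi) = of_int n * real \<beta> * (2 * pi)"
        using n \<beta>(1) by (simp add: field_simps)
      then have "real k * (real j - real i) = of_int n * real \<beta>" by simp
      then have "real_of_int (int (k * (j - i))) = real_of_int (n * int \<beta>)"
        using ij by simp
      then have "int (k * (j - i)) = n * int \<beta>" by (simp only: of_int_eq_iff)
      then have "int \<beta> dvd int (k * (j - i))" by simp
      then have dv: "\<beta> dvd k * (j - i)" by (simp only: int_dvd_int_iff)
      have "\<beta> dvd gcd (k * (j - i)) (k * \<beta>)"
        by (rule gcd_greatest[OF dv dvd_triv_right])
      then have "\<beta> dvd k * d" unfolding d_def gcd_mult_distrib_nat .
      then obtain k' where k': "k * d = \<beta> * k'" unfolding dvd_def by blast
      have "k' \<ge> 1" using k' k(1) d(1) by (cases k') auto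
      moreover have "e = of_nat k' / of_nat d"
      proof -
        have "(of_nat k :: rat) * of_nat d = of_nat \<beta> * of_nat k'"
          using arg_cong[OF k', of "of_nat :: nat \<Rightarrow> rat"] by (simp only: of_nat_mult)
        moreover have "(of_nat d :: rat) \<noteq> 0" "(of_nat \<beta> :: rat) \<noteq> 0"
          using d(1) \<beta>(1) by auto
        ultimately show ?thesis unfolding k(2) by (metis frac_eq_eq mult.commute)
      qed
      ultimately show "\<exists>k::nat. k \<ge> 1 \<and> e = of_nat k / of_nat d" by blast
    qed
    then have "ram q \<le> d"
      unfolding ram_def using d(1) by (simp add: Least_le)
    then show False using d(2) by (simp add: \<beta>_def)
  qed
qed auto

lemma card_circle:
  assumes "exp_factor q"
  shows "card (circle q) = ram q"
  using card_image[OF inj_on_conjugate[OF assms]] by (simp add: circle_eq_conjugates[OF assms])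

lemma irr_Hom_eq_sum_circle:
  assumes "exp_factor q" "exp_factor q'"
  shows "irr_Hom q q' = (\<Sum>p\<in>circle q. \<Sum>p'\<in>circle q'. slope (p - p'))"
  by (simp add: irr_Hom_def circle_eq_conjugates assms sum.reindex inj_on_conjugate)

lemma num_edges_cong:
  assumes "exp_factor q1" "exp_factor q2" "exp_factor q1'" "exp_factor q2'"
    and "circle q1 = circle q2" "circle q1' = circle q2'"
  shows "num_edges q1 q1' = num_edges q2 q2'"
  using assms by (simp add: num_edges_def irr_Hom_eq_sum_circle flip: card_circle)

end

theory Submission
  imports Defs
begin

text \<open>
  Conjugation multiplies the coefficient at the exponent e by exp(-2 \<pi> i e) for an integer i, whatever
  the ramification order, so the circle of q is the orbit of q under an action of the integers.
  Fix a conjugate of q. By the choice of r, some conjugate of q' has the same first r terms, and the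
  conjugates of q' that share its first s terms form a set of gcd_upto \<alpha>' \<beta>' s elements (a coset of
  a subgroup of the integers modulo \<beta>'). Those leaving at the s-th term, s < r, contribute the slope
  \<alpha> s / \<beta>; those sharing the first r terms contribute \<alpha> r / \<beta>, because a cancellation at that
  exponent would contradict the maximality of r.
\<close>

section \<open>Galois conjugation as an action of the integers\<close>

definition twist :: "int \<Rightarrow> puiseux \<Rightarrow> puiseux" where
  "twist i q = Poly_Mapping.mapp (\<lambda>e c. cis (- (2 * pi * of_int i * of_rat e)) * c) q"

lemma lookup_twist:
  "Poly_Mapping.lookup (twist i q) e = cis (- (2 * pi * of_int i * of_rat e)) * Poly_Mapping.lookup q e"
  by (auto simp: twist_def Poly_Mapping.lookup_mapp when_def in_keys_iff)

lemma keys_twist: "Poly_Mapping.keys (twist i q) = Poly_Mapping.keys q"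
  by (auto simp: in_keys_iff lookup_twist)

lemma twist_twist: "twist i (twist j q) = twist (i + j) q"
proof (rule poly_mapping_eqI)
  fix e
  have "cis (- (2 * pi * of_int (i + j) * of_rat e)) =
      cis (- (2 * pi * of_int i * of_rat e)) * cis (- (2 * pi * of_int j * of_rat e))"
    unfolding cis_mult by (rule arg_cong[of _ _ cis]) (simp add: algebra_simps)
  then show "Poly_Mapping.lookup (twist i (twist j q)) e = Poly_Mapping.lookup (twist (i + j) q) e"
    by (simp only: lookup_twist mult.assoc)
qed

lemma twist_0: "twist 0 q = q"
  by (rule poly_mapping_eqI) (simp add: lookup_twist)

text \<open>On the support, \<open>e\<close> is \<open>k\<close> over \<open>ram q\<close> for some
  integer \<open>k\<close>, so the floor is exactly \<open>k\<close> and the power of the root of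
  unity becomes the multiplier of \<open>twist\<close>. Off the support both coefficients
  vanish.\<close>

lemma conjugate_eq_twist:
  assumes "exp_factor q"
  shows "conjugate q i = twist (int i) q"
proof (rule poly_mapping_eqI)
  fix e
  note \<beta> = ram_props[OF assms]
  show "Poly_Mapping.lookup (conjugate q i) e = Poly_Mapping.lookup (twist (int i) q) e"
  proof (cases "e \<in> Poly_Mapping.keys q")
    case True
    then obtain k :: nat where k: "e = of_nat k / of_nat (ram q)"
      using \<beta>(2) by (auto simp: poly_in_root_def)
    have fl: "\<lfloor>of_nat (ram q) * e\<rfloor> = int k" using \<beta>(1) by (simp add: k)
    have "cis (2 * pi * real i / real (ram q)) powi (- int k)
        = cis (- (2 * pi * real i * of_rat e))"
      by (simp only: cis_power_int) (simp add: k of_rat_divide mult_ac)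
    then show ?thesis
      by (simp add: conjugate_def lookup_root_subst lookup_twist fl)
  qed (simp add: conjugate_def lookup_root_subst lookup_twist in_keys_iff)
qed

text \<open>Reducing \<open>i\<close> modulo \<open>\<beta>\<close> changes the angle at an exponent
  \<open>k/\<beta>\<close> by an integer multiple of 2 pi. This brings every integer back to an
  index of a conjugate.\<close>

lemma twist_mod:
  assumes "\<beta> \<ge> 1" "poly_in_root \<beta> q"
  shows "twist (i mod int \<beta>) q = twist i q"
proof (rule poly_mapping_eqI)
  fix e
  show "Poly_Mapping.lookup (twist (i mod int \<beta>) q) e = Poly_Mapping.lookup (twist i q) e"
  proof (cases "e \<in> Poly_Mapping.keys q")
    case True
    then obtain k :: nat where k: "e = of_nat k / of_nat \<beta>"
      using assms(2) by (auto simp: poly_in_root_def)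
    have "real_of_int i = real \<beta> * of_int (i div int \<beta>) + of_int (i mod int \<beta>)"
      by (metis mult_div_mod_eq of_int_add of_int_mult of_int_of_nat_eq)
    then have "- (2 * pi * of_int i * of_rat e) =
        - (2 * pi * of_int (i mod int \<beta>) * of_rat e) + 2 * pi * of_int (- (i div int \<beta>) * int k)"
      using assms(1) by (simp add: k of_rat_divide field_simps)
    moreover have "cis (2 * pi * of_int (- (i div int \<beta>) * int k)) = 1"
      by (rule cis_multiple_2pi) (rule Ints_of_int)
    ultimately have "cis (- (2 * pi * of_int i * of_rat e)) = cis (- (2 * pi * of_int (i mod int \<beta>) * of_rat e))"
      by (simp only: cis_mult[symmetric] mult_1_right)
    then show ?thesis by (simp add: lookup_twist)
  qed (simp add: lookup_twist in_keys_iff)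
qed

text \<open>Frees the circle from the ramification order. A truncation may have a smaller order than
  the whole factor, yet the same integers act on both.\<close>

lemma circle_eq_range_twist:
  assumes "exp_factor q"
  shows "circle q = range (\<lambda>i. twist i q)"
proof -
  note \<beta> = ram_props[OF assms]
  have "twist i q \<in> conjugate q ` {..<ram q}" for i
  proof (rule image_eqI)
    show "twist i q = conjugate q (nat (i mod int (ram q)))"
      using \<beta> by (simp add: conjugate_eq_twist[OF assms] twist_mod)
    show "nat (i mod int (ram q)) \<in> {..<ram q}"
      using \<beta>(1) by (simp add: nat_less_iff)
  qed
  then show ?thesis
    by (auto simp: circle_eq_conjugates[OF assms] conjugate_eq_twist[OF assms])
qed

text \<open>Two orbits of a group action that meet are equal: \<open>p\<close> is a twist of
  \<open>p'\<close>, and shifting the parameter matches the two ranges.\<close>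

lemma circle_eqI:
  assumes "exp_factor p" "exp_factor p'" "twist i p = twist j p'"
  shows "circle p = circle p'"
proof -
  have "twist (- i) (twist i p) = twist (- i) (twist j p')" by (simp add: assms)
  then have p: "p = twist (j - i) p'" by (simp add: twist_twist twist_0)
  have "range (\<lambda>k. twist k p) = range (\<lambda>k. twist k p')"
  proof safe
    fix k
    show "twist k p \<in> range (\<lambda>k. twist k p')" by (simp add: p twist_twist)
    have "twist k p' = twist (k - (j - i)) p" by (simp add: p twist_twist)
    then show "twist k p' \<in> range (\<lambda>k. twist k p)" by blast
  qed
  then show ?thesis using assms(1,2) by (simp only: circle_eq_range_twist)
qed

text \<open>The slope is the leading exponent: the numerators relative to \<open>ram p\<close>
  cancel against the denominator. Thus slopes of differences can be found without computing the
  ramification order of a difference.\<close>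

lemma slope_eqI:
  assumes "exp_factor p" "Poly_Mapping.lookup p e \<noteq> 0"
    and "\<And>e'. e' > e \<Longrightarrow> Poly_Mapping.lookup p e' = 0"
  shows "slope p = e"
proof -
  note \<beta> = ram_props[OF assms(1)]
  have "e \<in> Poly_Mapping.keys p" using assms(2) by (simp add: in_keys_iff)
  then obtain k :: nat where k: "k \<ge> 1" "e = of_nat k / of_nat (ram p)"
    using \<beta>(2) unfolding poly_in_root_def by blast
  have le: "l \<le> k" if "of_nat l / of_nat (ram p) \<in> Poly_Mapping.keys p" for l :: nat
  proof (rule ccontr)
    assume "\<not> l \<le> k"
    then have "(of_nat l / of_nat (ram p) :: rat) > e"
      using \<beta>(1) by (simp add: k divide_strict_right_mono)
    then show False using assms(3) that unfolding in_keys_iff by blast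
  qed
  have "Irr p = k" unfolding Irr_def
  proof (rule Max_eqI)
    show "finite (insert 0 {k. of_nat k / of_nat (ram p) \<in> Poly_Mapping.keys p})"
      by (rule finite_subset[of _ "{..k}"]) (auto dest!: le)
    show "k \<in> insert 0 {k. of_nat k / of_nat (ram p) \<in> Poly_Mapping.keys p}"
      using \<open>e \<in> Poly_Mapping.keys p\<close> by (simp add: k(2))
  qed (auto dest!: le)
  then show ?thesis by (simp add: slope_def k)
qed

lemma poly_in_root_mult:
  assumes "poly_in_root \<beta> p" "m \<ge> 1"
  shows "poly_in_root (\<beta> * m) p"
  unfolding poly_in_root_def
proof
  fix e assume "e \<in> Poly_Mapping.keys p"
  then obtain k :: nat where "k \<ge> 1" "e = of_nat k / of_nat \<beta>"
    using assms(1) by (auto simp: poly_in_root_def)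
  then show "\<exists>k::nat. k \<ge> 1 \<and> e = of_nat k / of_nat (\<beta> * m)"
    using assms(2) by (intro exI[of _ "k * m"]) auto
qed

text \<open>The product of two root orders is a common denominator; it need not be the ramification
  order of the difference.\<close>

lemma exp_factor_diff:
  assumes "exp_factor p" "exp_factor q"
  shows "exp_factor (p - q)"
proof -
  obtain \<beta> \<gamma> where "\<beta> \<ge> 1" "\<gamma> \<ge> 1" "poly_in_root \<beta> p" "poly_in_root \<gamma> q"
    using assms by (auto simp: exp_factor_def)
  then have "\<beta> * \<gamma> \<ge> 1" "poly_in_root (\<beta> * \<gamma>) p" "poly_in_root (\<beta> * \<gamma>) q"
    using poly_in_root_mult[of \<beta> p \<gamma>] poly_in_root_mult[of \<gamma> q \<beta>] by (auto simp: mult.commute)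
  moreover have "Poly_Mapping.keys (p - q) \<subseteq> Poly_Mapping.keys p \<union> Poly_Mapping.keys q"
    by (auto simp: in_keys_iff lookup_minus)
  ultimately show ?thesis
    unfolding exp_factor_def poly_in_root_def by blast
qed

lemma exp_factor_twist: "exp_factor p \<Longrightarrow> exp_factor (twist i p)"
  by (simp add: exp_factor_def poly_in_root_def keys_twist)

section \<open>Coefficients of explicit sums\<close>

lemma lookup_puiseux_sum:
  "Poly_Mapping.lookup (puiseux_sum b \<alpha> \<beta> m) e = (\<Sum>j<m. b j when of_nat (\<alpha> j) / of_nat \<beta> = e)"
  by (simp add: puiseux_sum_def lookup_sum lookup_single)

lemma lookup_puiseux_sum_at:
  assumes "\<beta> \<ge> 1" "j < m" "\<And>i j. i < j \<Longrightarrow> j < m \<Longrightarrow> \<alpha> j < \<alpha> i"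
  shows "Poly_Mapping.lookup (puiseux_sum b \<alpha> \<beta> m) (of_nat (\<alpha> j) / of_nat \<beta>) = b j"
proof -
  have "\<alpha> i \<noteq> \<alpha> j" if "i < m" "i \<noteq> j" for i
    using assms(2) assms(3)[of i j] assms(3)[of j i] that by (cases i j rule: linorder_cases) auto
  then have "Poly_Mapping.lookup (puiseux_sum b \<alpha> \<beta> m) (of_nat (\<alpha> j) / of_nat \<beta>) =
      (\<Sum>i<m. if i = j then b j else 0)"
    unfolding lookup_puiseux_sum using assms(1) by (intro sum.cong) (auto simp: when_def)
  then show ?thesis using assms(2) by simp
qed

lemma lookup_puiseux_sum_outside:
  assumes "\<And>j. j < m \<Longrightarrow> e \<noteq> of_nat (\<alpha> j) / of_nat \<beta>"
  shows "Poly_Mapping.lookup (puiseux_sum b \<alpha> \<beta> m) e = 0"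
  unfolding lookup_puiseux_sum using assms by (intro sum.neutral) (auto simp: when_def)

section \<open>Greatest common divisors, congruences and counting\<close>

lemma gcd_upto_0: "gcd_upto \<alpha> \<beta> 0 = \<beta>"
  by (simp add: gcd_upto_def)

lemma gcd_upto_Suc: "gcd_upto \<alpha> \<beta> (Suc m) = gcd (\<alpha> m) (gcd_upto \<alpha> \<beta> m)"
  by (simp only: gcd_upto_def lessThan_Suc image_insert Gcd_insert gcd.left_commute)

lemma gcd_upto_dvd: "gcd_upto \<alpha> \<beta> m dvd \<beta>"
  by (simp add: gcd_upto_def)

text \<open>Merges one congruence per exponent into a single one that can be counted. Up to sign,
  multiplication by \<open>x\<close> commutes with gcd; the member \<open>\<beta>\<close> of the gcd
  adds only a trivial condition.\<close>

lemma dvd_mult_gcd_upto_iff: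
  "int \<beta> dvd x * int (gcd_upto \<alpha> \<beta> m) \<longleftrightarrow> (\<forall>t<m. int \<beta> dvd x * int (\<alpha> t))"
proof (induction m)
  case (Suc m)
  have "int \<beta> dvd x * gcd a b \<longleftrightarrow> int \<beta> dvd x * a \<and> int \<beta> dvd x * b" for a b :: int
  proof -
    have "\<bar>x * gcd a b\<bar> = gcd (x * a) (x * b)"
      by (simp only: abs_mult gcd_mult_distrib_int[symmetric]) simp
    then have "int \<beta> dvd x * gcd a b \<longleftrightarrow> int \<beta> dvd gcd (x * a) (x * b)"
      using dvd_abs_iff[of "int \<beta>" "x * gcd a b"] by simp
    then show ?thesis by (simp only: gcd_greatest_iff)
  qed
  then have "int \<beta> dvd x * gcd (int (\<alpha> m)) (int (gcd_upto \<alpha> \<beta> m)) \<longleftrightarrow>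
      int \<beta> dvd x * int (\<alpha> m) \<and> int \<beta> dvd x * int (gcd_upto \<alpha> \<beta> m)" .
  then show ?case using Suc by (auto simp: gcd_upto_Suc less_Suc_eq)
qed (simp add: gcd_upto_0)

text \<open>The two angles differ by 2 pi times \<open>(i - j) * a / \<beta>\<close>, up to sign.
  The criterion decides when the twists by \<open>i\<close> and \<open>j\<close> act equally on the
  term with exponent \<open>a/\<beta>\<close>.\<close>

lemma cis_eq_iff_dvd:
  assumes "\<beta> \<ge> 1"
  shows "cis (- (2 * pi * of_int i * of_rat (of_nat a / of_nat \<beta>))) =
      cis (- (2 * pi * of_int j * of_rat (of_nat a / of_nat \<beta>))) \<longleftrightarrow> int \<beta> dvd (i - j) * int a"
proof -
  define u where "u = - (2 * pi * of_int i * of_rat (of_nat a / of_nat \<beta>))"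
  define v where "v = - (2 * pi * of_int j * of_rat (of_nat a / of_nat \<beta>))"
  have "cis u = cis v \<longleftrightarrow> cis u / cis v = 1" by simp
  also have "\<dots> \<longleftrightarrow> (\<exists>n::int. u - v = of_int n * (2 * pi))"
    by (simp add: cis_divide cis_eq_1_iff)
  also have "\<dots> \<longleftrightarrow> (\<exists>n. (i - j) * int a = int \<beta> * n)"
  proof -
    have "u - v = of_int n * (2 * pi) \<longleftrightarrow> (i - j) * int a = int \<beta> * (- n)" for n
    proof -
      have "u - v = of_int n * (2 * pi) \<longleftrightarrow> - (of_int ((i - j) * int a) / real \<beta>) * (2 * pi) = of_int n * (2 * pi)"
        by (simp add: u_def v_def of_rat_divide diff_divide_distrib algebra_simps)
      also have "\<dots> \<longleftrightarrow> - (of_int ((i - j) * int a) / real \<beta>) = of_int n"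
        by (subst mult_cancel_right) simp
      also have "\<dots> \<longleftrightarrow> (of_int ((i - j) * int a) :: real) = of_int (int \<beta> * (- n))"
        using assms by (auto simp: field_simps)
      finally show ?thesis by (simp only: of_int_eq_iff)
    qed
    then show ?thesis by (metis minus_minus)
  qed
  also have "\<dots> \<longleftrightarrow> int \<beta> dvd (i - j) * int a" by (simp add: dvd_def)
  finally show ?thesis by (simp add: u_def v_def)
qed

text \<open>With \<open>\<beta> = g * m\<close> the condition says that \<open>j\<close> lies in the
  residue class of \<open>k\<close> modulo \<open>m\<close>, which has one member in each of the
  \<open>g\<close> blocks of length \<open>m\<close> below \<open>\<beta>\<close>.\<close>

lemma card_dvd_diff_mult:
  assumes "\<beta> \<ge> 1" "g dvd \<beta>"
  shows "card {j. j < \<beta> \<and> int \<beta> dvd (int j - k) * int g} = g"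
proof -
  obtain m where m: "\<beta> = g * m" using assms(2) by (auto simp: dvd_def)
  have pos: "g > 0" "m > 0" using assms(1) m by (auto intro: Nat.gr0I)
  define c where "c = nat (k mod int m)"
  have c: "c < m" "int c = k mod int m" using pos by (auto simp: c_def nat_less_iff)
  have "int \<beta> dvd (int j - k) * int g \<longleftrightarrow> j mod m = c" for j
  proof -
    have "int \<beta> dvd (int j - k) * int g \<longleftrightarrow> int m dvd int j - k"
      using pos by (simp add: m mult.commute)
    also have "\<dots> \<longleftrightarrow> int (j mod m) = int c"
      by (simp only: mod_eq_dvd_iff[symmetric] c zmod_int)
    finally show ?thesis by (simp only: of_nat_eq_iff)
  qed
  then have "{j. j < \<beta> \<and> int \<beta> dvd (int j - k) * int g} = {j. j < g * m \<and> j mod m = c}"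
    by (simp add: m)
  also have "\<dots> = (\<lambda>t. t * m + c) ` {..<g}"
  proof (intro set_eqI iffI)
    fix j assume "j \<in> {j. j < g * m \<and> j mod m = c}"
    then have "j div m < g" "j = j div m * m + c"
      by (auto simp: less_mult_imp_div_less)
    then show "j \<in> (\<lambda>t. t * m + c) ` {..<g}" by blast
  next
    fix j assume "j \<in> (\<lambda>t. t * m + c) ` {..<g}"
    then obtain t where t: "t < g" "j = t * m + c" by auto
    have "t * m + c < Suc t * m" using c by simp
    also have "\<dots> \<le> g * m" using t by (intro mult_right_mono) auto
    finally show "j \<in> {j. j < g * m \<and> j mod m = c}" using t c by simp
  qed
  also have "card \<dots> = g"
    using pos by (subst card_image) (auto simp: inj_on_def)
  finally show ?thesis .
qed

text \<open>Peels off the layers \<open>A s - A (Suc s)\<close>, on each of which \<open>f\<close>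
  is constant. In the application \<open>A s\<close> collects the conjugates of \<open>q'\<close>
  sharing their first \<open>s\<close> terms with a fixed one, and \<open>f\<close> is the slope of
  a difference.\<close>

lemma sum_over_filtration:
  fixes f :: "'a \<Rightarrow> rat"
  assumes "finite (A 0)" "\<And>s. A (Suc s) \<subseteq> A s"
    and "\<And>s j. s < r \<Longrightarrow> j \<in> A s - A (Suc s) \<Longrightarrow> f j = c s"
    and "\<And>j. j \<in> A r \<Longrightarrow> f j = c r"
  shows "sum f (A 0) = (\<Sum>s<r. (of_nat (card (A s)) - of_nat (card (A (Suc s)))) * c s) + of_nat (card (A r)) * c r"
proof -
  have fin: "finite (A s)" for s
    by (induction s) (use assms(1,2) finite_subset in blast)+
  \<comment> \<open>The remainder stays a sum over \<open>A m\<close> during the induction;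
    constancy on \<open>A r\<close> enters only at the end.\<close>
  have "sum f (A 0) = (\<Sum>s<m. (of_nat (card (A s)) - of_nat (card (A (Suc s)))) * c s) + sum f (A m)"
    if "m \<le> r" for m
    using that
  proof (induction m)
    case (Suc m)
    have "sum f (A m) = sum f (A m - A (Suc m)) + sum f (A (Suc m))"
      by (rule sum.subset_diff[OF assms(2) fin])
    also have "sum f (A m - A (Suc m)) = (\<Sum>j\<in>A m - A (Suc m). c m)"
      using Suc.prems by (intro sum.cong assms(3)) auto
    also have "\<dots> = (of_nat (card (A m)) - of_nat (card (A (Suc m)))) * c m"
      by (simp add: card_Diff_subset fin assms(2) card_mono of_nat_diff)
    finally show ?case using Suc by simp
  qed simp
  from this[of r] show ?thesis using assms(4) by simp
qed

text \<open>By strong induction, \<open>f j\<close> is some \<open>g k\<close>, and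
  \<open>k < j\<close> would give \<open>f j = f k\<close>; so \<open>f j \<le> g j\<close>, and
  symmetrically. It turns equality of the sets of exponents of two truncations into termwise
  equality.\<close>

lemma strict_antimono_enumeration_unique:
  fixes f g :: "nat \<Rightarrow> 'a::linorder"
  assumes f: "\<And>i j. i < j \<Longrightarrow> j < r \<Longrightarrow> f j < f i"
    and g: "\<And>i j. i < j \<Longrightarrow> j < r \<Longrightarrow> g j < g i"
    and fg: "f ` {..<r} = g ` {..<r}"
    and "j < r"
  shows "f j = g j"
  using \<open>j < r\<close>
proof (induction j rule: less_induct)
  case (less j)
  have "f j \<in> g ` {..<r}" using less.prems fg by blast
  then obtain k where k: "k < r" "f j = g k" by auto
  have "\<not> k < j" using less.IH[of k] k f[of k j] less.prems by auto
  then have "f j \<le> g j" using k g[of j k] by (cases "k = j") auto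
  moreover
  have "g j \<in> f ` {..<r}" using less.prems fg by blast
  then obtain l where l: "l < r" "g j = f l" by auto
  have "\<not> l < j" using less.IH[of l] l g[of l j] less.prems by auto
  then have "g j \<le> f j" using l f[of j l] by (cases "l = j") auto
  ultimately show ?case by simp
qed

text \<open>Passes from numerators over \<open>ram q\<close> to rational exponents
  \<open>E j\<close>, which can be compared between factors of different orders. A truncation keeps
  some coefficients of \<open>q\<close> and deletes the others, so a root order of \<open>q\<close>
  also serves for it.\<close>

lemma expansion_props:
  assumes "exp_factor q" "expansion q n b \<alpha>"
  defines "E \<equiv> \<lambda>j. of_nat (\<alpha> j) / of_nat (ram q) :: rat"
  shows expansion_at: "j < n \<Longrightarrow> Poly_Mapping.lookup q (E j) = b j"
    and expansion_coeff: "j < n \<Longrightarrow> b j \<noteq> 0"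
    and expansion_support: "Poly_Mapping.lookup q e \<noteq> 0 \<Longrightarrow> \<exists>j<n. e = E j"
    and expansion_strict: "i < j \<Longrightarrow> j < n \<Longrightarrow> E j < E i"
    and expansion_pos: "j < n \<Longrightarrow> E j > 0"
    and expansion_beyond: "j \<ge> n \<Longrightarrow> E j = 0"
    and expansion_antimono: "i \<le> j \<Longrightarrow> E j \<le> E i"
    and expansion_total: "puiseux_sum b \<alpha> (ram q) n = q"
    and lookup_truncation: "s \<le> n \<Longrightarrow> Poly_Mapping.lookup (puiseux_sum b \<alpha> (ram q) s) e =
          (if \<exists>j<s. e = E j then Poly_Mapping.lookup q e else 0)"
    and exp_factor_truncation: "s \<le> n \<Longrightarrow> exp_factor (puiseux_sum b \<alpha> (ram q) s)"
proof -
  note \<beta> = ram_props[OF assms(1)]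
  from assms(2) have q: "q = puiseux_sum b \<alpha> (ram q) n"
    and b: "\<And>j. j < n \<Longrightarrow> b j \<noteq> 0"
    and dec: "\<And>i j. i < j \<Longrightarrow> j < n \<Longrightarrow> \<alpha> j < \<alpha> i"
    and zero: "\<And>j. j \<ge> n \<Longrightarrow> \<alpha> j = 0"
    unfolding expansion_def by blast+
  show "j < n \<Longrightarrow> b j \<noteq> 0" for j by (rule b)
  show total: "puiseux_sum b \<alpha> (ram q) n = q" using q by (rule sym)
  have at: "Poly_Mapping.lookup (puiseux_sum b \<alpha> (ram q) s) (E j) = b j" if "j < s" "s \<le> n" for j s
    unfolding E_def by (rule lookup_puiseux_sum_at[OF \<beta>(1) that(1)]) (use dec that in auto)
  have out: "Poly_Mapping.lookup (puiseux_sum b \<alpha> (ram q) s) e = 0" if "\<not> (\<exists>j<s. e = E j)" for e s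
    by (rule lookup_puiseux_sum_outside) (use that in \<open>auto simp: E_def\<close>)
  show at_q: "Poly_Mapping.lookup q (E j) = b j" if "j < n" for j
    using at[OF that order_refl] unfolding total .
  show "\<exists>j<n. e = E j" if "Poly_Mapping.lookup q e \<noteq> 0" for e
    using out[of n e] that unfolding total by blast
  show strict: "E j < E i" if "i < j" "j < n" for i j
    using dec[OF that] \<beta>(1) by (simp add: E_def divide_strict_right_mono)
  \<comment> \<open>Strict decrease alone would allow the last exponent to be 0; the absence of a
    constant term excludes this.\<close>
  show pos: "E j > 0" if "j < n" for j
  proof -
    have "E j \<in> Poly_Mapping.keys q" using at_q[OF that] b[OF that] by (simp add: in_keys_iff)
    then obtain k :: nat where "k \<ge> 1" "E j = of_nat k / of_nat (ram q)"
      using \<beta>(2) unfolding poly_in_root_def by blast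
    then show ?thesis using \<beta>(1) by simp
  qed
  show beyond: "E j = 0" if "j \<ge> n" for j
    using zero[OF that] by (simp add: E_def)
  show "E j \<le> E i" if "i \<le> j" for i j
  proof (cases "j < n")
    case True
    then show ?thesis using strict[of i j] that by (cases "i = j") auto
  next
    case False
    then have "E j = 0" by (simp add: beyond)
    moreover have "0 \<le> E i" by (simp add: E_def)
    ultimately show ?thesis by simp
  qed
  show trunc: "Poly_Mapping.lookup (puiseux_sum b \<alpha> (ram q) s) e =
      (if \<exists>j<s. e = E j then Poly_Mapping.lookup q e else 0)" if "s \<le> n" for s e
    using at[OF _ that] at_q out[of s e] that by auto
  show "exp_factor (puiseux_sum b \<alpha> (ram q) s)" if "s \<le> n" for s
  proof -
    have "Poly_Mapping.keys (puiseux_sum b \<alpha> (ram q) s) \<subseteq> Poly_Mapping.keys q"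
      by (auto simp: in_keys_iff trunc[OF that] split: if_splits)
    then show ?thesis using \<beta> unfolding exp_factor_def poly_in_root_def by blast
  qed
qed

theorem lemma4p5:
  fixes q q' :: puiseux
    and n n' r \<beta> \<beta>' :: nat
    and b b' :: "nat \<Rightarrow> complex"
    and \<alpha> \<alpha>' :: "nat \<Rightarrow> nat"
  assumes "exp_factor q" and "exp_factor q'"
    and "circle q \<noteq> circle q'"
    and "\<beta> = ram q" and "\<beta>' = ram q'"
    and "expansion q n b \<alpha>" and "expansion q' n' b' \<alpha>'"
    and "r = (GREATEST s. s \<le> n \<and> s \<le> n' \<and>
                circle (puiseux_sum b \<alpha> \<beta> s) = circle (puiseux_sum b' \<alpha>' \<beta>' s))"
  shows "((of_nat (\<alpha> r) / of_nat \<beta> :: rat) \<ge> of_nat (\<alpha>' r) / of_nat \<beta>' \<longrightarrow>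
           num_edges q q' =
             (\<Sum>j<r. (of_nat (gcd_upto \<alpha>' \<beta>' j) - of_nat (gcd_upto \<alpha>' \<beta>' (Suc j))) * of_nat (\<alpha> j))
             + of_nat (gcd_upto \<alpha>' \<beta>' r) * of_nat (\<alpha> r) - of_nat \<beta> * of_nat \<beta>')
       \<and> (r = 0 \<and> (of_nat (\<alpha> 0) / of_nat \<beta> :: rat) \<ge> of_nat (\<alpha>' 0) / of_nat \<beta>' \<longrightarrow>
           num_edges q q' = of_nat \<beta>' * (of_nat (\<alpha> 0) - of_nat \<beta>))"
proof -
  have q: "exp_factor q" and q': "exp_factor q'" and ne: "circle q \<noteq> circle q'"
    and \<beta>: "\<beta> = ram q" and \<beta>': "\<beta>' = ram q'"
    and ex: "expansion q n b \<alpha>" and ex': "expansion q' n' b' \<alpha>'" by fact+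
  have \<beta>1: "\<beta> \<ge> 1" "\<beta>' \<ge> 1" using ram_props(1) q q' \<beta> \<beta>' by auto
  define E where "E j = (of_nat (\<alpha> j) / of_nat \<beta> :: rat)" for j
  define E' where "E' j = (of_nat (\<alpha>' j) / of_nat \<beta>' :: rat)" for j
  define T where "T = puiseux_sum b \<alpha> \<beta>"
  define T' where "T' = puiseux_sum b' \<alpha>' \<beta>'"
  note at = expansion_at[OF q ex, folded \<beta>, folded E_def T_def]
    and coeff = expansion_coeff[OF q ex, folded \<beta>, folded E_def T_def]
    and support = expansion_support[OF q ex, folded \<beta>, folded E_def T_def]
    and strict = expansion_strict[OF q ex, folded \<beta>, folded E_def T_def]
    and pos = expansion_pos[OF q ex, folded \<beta>, folded E_def T_def]
    and beyond = expansion_beyond[OF q ex, folded \<beta>, folded E_def T_def]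
    and antimono = expansion_antimono[OF q ex, folded \<beta>, folded E_def T_def]
    and total = expansion_total[OF q ex, folded \<beta>, folded E_def T_def]
    and trunc = lookup_truncation[OF q ex, folded \<beta>, folded E_def T_def]
    and eT = exp_factor_truncation[OF q ex, folded \<beta>, folded E_def T_def]
  note at' = expansion_at[OF q' ex', folded \<beta>', folded E'_def T'_def]
    and coeff' = expansion_coeff[OF q' ex', folded \<beta>', folded E'_def T'_def]
    and support' = expansion_support[OF q' ex', folded \<beta>', folded E'_def T'_def]
    and strict' = expansion_strict[OF q' ex', folded \<beta>', folded E'_def T'_def]
    and pos' = expansion_pos[OF q' ex', folded \<beta>', folded E'_def T'_def]
    and beyond' = expansion_beyond[OF q' ex', folded \<beta>', folded E'_def T'_def]
    and antimono' = expansion_antimono[OF q' ex', folded \<beta>', folded E'_def T'_def]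
    and total' = expansion_total[OF q' ex', folded \<beta>', folded E'_def T'_def]
    and trunc' = lookup_truncation[OF q' ex', folded \<beta>', folded E'_def T'_def]
    and eT' = exp_factor_truncation[OF q' ex', folded \<beta>', folded E'_def T'_def]
  define P where "P s \<longleftrightarrow> s \<le> n \<and> s \<le> n' \<and> circle (T s) = circle (T' s)" for s
  have r: "r = (GREATEST s. P s)"
    unfolding P_def T_def T'_def by fact
  \<comment> \<open>\<open>GREATEST\<close> needs a nonempty bounded set: both empty truncations are
    zero, and \<open>n\<close> is a bound.\<close>
  have "P 0" by (simp add: P_def T_def T'_def puiseux_sum_def)
  moreover have bound: "\<And>s. P s \<Longrightarrow> s \<le> n" by (simp add: P_def)
  ultimately have "P r" unfolding r by (rule GreatestI_nat)
  then have rn: "r \<le> n" "r \<le> n'" and Tr: "circle (T r) = circle (T' r)" by (auto simp: P_def)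
  \<comment> \<open>When \<open>r\<close> equals \<open>n\<close> or \<open>n'\<close>,
    \<open>P (Suc r)\<close> fails by its bounds alone, so the circles are known to differ only if
    both factors have a term of index \<open>r\<close>.\<close>
  have "\<not> P (Suc r)"
    using Greatest_le_nat[of P "Suc r" n] bound r by auto
  then have maximal: "circle (T (Suc r)) \<noteq> circle (T' (Suc r))" if "r < n" "r < n'"
    using that by (simp add: P_def)

  \<comment> \<open>Equality of the first \<open>r\<close> exponents\<close>
  have keys_T: "Poly_Mapping.keys (T r) = E ` {..<r}"
    using rn at coeff by (auto simp: in_keys_iff trunc split: if_splits)
  have keys_T': "Poly_Mapping.keys (T' r) = E' ` {..<r}"
    using rn at' coeff' by (auto simp: in_keys_iff trunc' split: if_splits)
  \<comment> \<open>Equal circles make \<open>T r\<close> a twist of \<open>T' r\<close>, and a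
    twist preserves the support.\<close>
  have "T r \<in> circle (T r)"
    using twist_0[of "T r"] by (metis circle_eq_range_twist[OF eT[OF rn(1)]] rangeI)
  then obtain l where "T r = twist l (T' r)"
    unfolding Tr circle_eq_range_twist[OF eT'[OF rn(2)]] by blast
  then have images: "E ` {..<r} = E' ` {..<r}"
    using keys_twist[of l "T' r"] keys_T keys_T' by simp
  have EE: "E t = E' t" if "t < r" for t
    by (rule strict_antimono_enumeration_unique[OF _ _ images that]) (use strict strict' rn in auto)

  \<comment> \<open>Slopes of the differences and the edge count\<close>
  have part1: "num_edges q q' =
      (\<Sum>j<r. (of_nat (gcd_upto \<alpha>' \<beta>' j) - of_nat (gcd_upto \<alpha>' \<beta>' (Suc j))) * of_nat (\<alpha> j))
      + of_nat (gcd_upto \<alpha>' \<beta>' r) * of_nat (\<alpha> r) - of_nat \<beta> * of_nat \<beta>'"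
    if ge: "E' r \<le> E r"
  proof -
    \<comment> \<open>If \<open>r = n\<close>, then \<open>E r = 0\<close> by convention, so
      \<open>ge\<close> and positivity of the exponents of \<open>q'\<close> force
      \<open>r = n'\<close>. The truncations are then \<open>q\<close> and \<open>q'\<close>, whose
      circles differ.\<close>
    have r_n: "r < n"
    proof (rule ccontr)
      assume "\<not> r < n"
      then have "r = n" using rn by simp
      then have "\<not> r < n'" using pos'[of r] ge beyond[of r] by auto
      then have "r = n'" using rn by simp
      then show False using Tr ne total total' \<open>r = n\<close> by simp
    qed
    define g where "g = gcd_upto \<alpha>' \<beta>'"
    have inner: "(\<Sum>j<\<beta>'. slope (twist i q - twist (int j) q')) =
        (\<Sum>s<r. (of_nat (g s) - of_nat (g (Suc s))) * E s) + of_nat (g r) * E r" for i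
    proof -
      \<comment> \<open>This yields the base point \<open>j0\<close>: the twist of \<open>q'\<close>
        by \<open>j0\<close> begins with the same \<open>r\<close> terms as the twist of
        \<open>q\<close> by \<open>i\<close>.\<close>
      have "twist i (T r) \<in> circle (T r)"
        unfolding circle_eq_range_twist[OF eT[OF rn(1)]] by blast
      then obtain j0 where j0: "twist i (T r) = twist j0 (T' r)"
        unfolding Tr circle_eq_range_twist[OF eT'[OF rn(2)]] by blast
      define c where "c j e = cis (- (2 * pi * of_int j * of_rat e))" for j e
      have cb: "c i (E t) * b t = c j0 (E t) * b' t" if t: "t < r" for t
      proof -
        have "Poly_Mapping.lookup (T r) (E t) = b t"
          using at[of t] t rn by (auto simp: trunc)
        moreover have "Poly_Mapping.lookup (T' r) (E t) = b' t"
          using at'[of t] t rn EE[OF t] by (auto simp: trunc')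
        ultimately show ?thesis
          using arg_cong[OF j0, of "\<lambda>p. Poly_Mapping.lookup p (E t)"]
          unfolding lookup_twist c_def by simp
      qed
      define D where "D j = twist i q - twist (int j) q'" for j
      have lookup_tw: "Poly_Mapping.lookup (twist k p) e = c k e * Poly_Mapping.lookup p e" for k p e
        by (simp add: lookup_twist c_def)
      have lookup_D: "Poly_Mapping.lookup (D j) e =
          c i e * Poly_Mapping.lookup q e - c (int j) e * Poly_Mapping.lookup q' e" for j e
        by (simp only: D_def lookup_minus lookup_tw)
      \<comment> \<open>By \<open>cb\<close>, the coefficient of \<open>q\<close> can be replaced by
        that of \<open>q'\<close>; cancellation then depends only on comparing \<open>j\<close> with
        \<open>j0\<close>.\<close>
      have D_common: "Poly_Mapping.lookup (D j) (E t) = (c j0 (E t) - c (int j) (E t)) * b' t"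
        if t: "t < r" for j t
        using at[of t] at'[of t] t rn EE[OF t] cb[OF t] by (simp add: lookup_D left_diff_distrib)
      have D_exp: "exp_factor (D j)" for j
        unfolding D_def by (intro exp_factor_diff exp_factor_twist q q')
      \<comment> \<open>The congruence form is what gets counted; \<open>A_iff\<close> recovers its
        meaning, agreement with the base point \<open>j0\<close> on the first \<open>s\<close>
        terms.\<close>
      define A where "A s = {j. j < \<beta>' \<and> int \<beta>' dvd (int j - j0) * int (g s)}" for s
      have A_iff: "j \<in> A s \<longleftrightarrow> j < \<beta>' \<and> (\<forall>t<s. c (int j) (E' t) = c j0 (E' t))" for j s
        unfolding A_def g_def c_def E'_def mem_Collect_eq dvd_mult_gcd_upto_iff
        by (simp only: cis_eq_iff_dvd[OF \<beta>1(2)])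
      have card_A: "card (A s) = g s" for s
        unfolding A_def by (rule card_dvd_diff_mult[OF \<beta>1(2)]) (simp add: g_def gcd_upto_dvd)
      \<comment> \<open>An exponent above both \<open>E s\<close> and \<open>E' s\<close> can only
        have an index below \<open>s\<close>, where the exponents are common and the terms cancel.
        For \<open>s = r\<close> the two bounds may differ.\<close>
      have above: "Poly_Mapping.lookup (D j) e = 0"
        if s: "s \<le> r" "j \<in> A s" and e: "E s < e" "E' s < e" for s j e
      proof (rule ccontr)
        assume "Poly_Mapping.lookup (D j) e \<noteq> 0"
        then have "Poly_Mapping.lookup q e \<noteq> 0 \<or> Poly_Mapping.lookup q' e \<noteq> 0"
          by (auto simp: lookup_D)
        then obtain t where t: "e = E t \<or> e = E' t" using support support' by blast
        have "t < s" using t antimono[of s t] antimono'[of s t] e by (cases "t < s") auto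
        then have "t < r" using s by simp
        then have "e = E t" using t EE by auto
        moreover have "c (int j) (E t) = c j0 (E t)"
          using s \<open>t < s\<close> EE[OF \<open>t < r\<close>] by (simp add: A_iff)
        ultimately show False
          using D_common[OF \<open>t < r\<close>, of j] \<open>Poly_Mapping.lookup (D j) e \<noteq> 0\<close> by simp
      qed
      have "sum (\<lambda>j. slope (D j)) (A 0) =
          (\<Sum>s<r. (of_nat (card (A s)) - of_nat (card (A (Suc s)))) * E s) + of_nat (card (A r)) * E r"
      proof (rule sum_over_filtration)
        show "finite (A 0)" by (simp add: A_def)
        show "A (Suc s) \<subseteq> A s" for s by (auto simp: A_iff)
      next
        fix s j assume s: "s < r" and j: "j \<in> A s - A (Suc s)"
        \<comment> \<open>Agreement holds before index \<open>s\<close> and fails at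
          \<open>s\<close>, so the leading exponent of the difference is \<open>E s\<close>.\<close>
        then have "c (int j) (E' s) \<noteq> c j0 (E' s)" by (auto simp: A_iff less_Suc_eq)
        then have "Poly_Mapping.lookup (D j) (E s) \<noteq> 0"
          using D_common[OF s] EE[OF s] coeff'[of s] s rn by auto
        then show "slope (D j) = E s"
          using above[of s j] s j EE[OF s] by (intro slope_eqI D_exp) auto
      next
        fix j assume j: "j \<in> A r"
        have "Poly_Mapping.lookup (D j) (E r) \<noteq> 0"
        proof
          \<comment> \<open>A cancellation requires a term of \<open>q'\<close> at
            \<open>E r\<close>. Its index is \<open>r\<close>: smaller indices give larger
            exponents, and larger ones give exponents below \<open>E' r \<le> E r\<close>. Then
            twists of the truncations of length \<open>Suc r\<close> coincide, against
            maximality.\<close>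
          assume zero: "Poly_Mapping.lookup (D j) (E r) = 0"
          have "c i (E r) * Poly_Mapping.lookup q (E r) \<noteq> 0"
            using at[OF r_n] coeff[OF r_n] by (simp add: c_def)
          with zero have "Poly_Mapping.lookup q' (E r) \<noteq> 0" by (auto simp: lookup_D)
          then obtain t where t: "t < n'" "E r = E' t" using support' by blast
          have "\<not> t < r" using EE[of t] t strict[of t r] r_n by auto
          moreover have "\<not> r < t" using strict'[of r t] t ge by auto
          ultimately have "t = r" by simp
          with t have r_n': "r < n'" and Er: "E r = E' r" by auto
          have "twist i (T (Suc r)) = twist (int j) (T' (Suc r))"
          proof (rule poly_mapping_eqI)
            fix e
            have "(\<exists>t<Suc r. e = E t) \<longleftrightarrow> (\<exists>t<Suc r. e = E' t)"
              using EE Er by (auto simp: less_Suc_eq)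
            moreover have "Poly_Mapping.lookup (D j) e = 0" if "t < Suc r" "e = E t" for t
              using that j zero D_common[of t j] EE[of t] by (cases "t = r") (auto simp: A_iff)
            then have "c i e * Poly_Mapping.lookup q e = c (int j) e * Poly_Mapping.lookup q' e"
              if "\<exists>t<Suc r. e = E t"
              using that by (auto simp: lookup_D)
            ultimately show "Poly_Mapping.lookup (twist i (T (Suc r))) e =
                Poly_Mapping.lookup (twist (int j) (T' (Suc r))) e"
              using r_n r_n' by (simp add: lookup_tw trunc trunc' Suc_le_eq) blast
          qed
          then have "circle (T (Suc r)) = circle (T' (Suc r))"
            using r_n r_n' by (intro circle_eqI eT eT') auto
          then show False using maximal r_n r_n' by simp
        qed
        then show "slope (D j) = E r"
          \<comment> \<open>By \<open>ge\<close>, an exponent above \<open>E r\<close> is also above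
            \<open>E' r\<close>, as \<open>above\<close> requires.\<close>
          using above[of r j] j ge by (intro slope_eqI D_exp) auto
      qed
      moreover have "A 0 = {..<\<beta>'}" by (auto simp: A_iff)
      ultimately show ?thesis by (simp only: card_A D_def)
    qed
    \<comment> \<open>The value in \<open>inner\<close> is independent of \<open>i\<close>, so the
      outer sum contributes a factor \<open>\<beta>\<close>, which clears the denominators of the
      \<open>E s\<close>.\<close>
    have \<beta>E: "of_nat \<beta> * E s = of_nat (\<alpha> s)" for s
      using \<beta>1 by (simp add: E_def)
    have "irr_Hom q q' = (\<Sum>i<\<beta>. \<Sum>j<\<beta>'. slope (twist (int i) q - twist (int j) q'))"
      by (simp only: irr_Hom_def \<beta> \<beta>' conjugate_eq_twist[OF q] conjugate_eq_twist[OF q'])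
    also have "\<dots> = of_nat \<beta> *
        ((\<Sum>s<r. (of_nat (g s) - of_nat (g (Suc s))) * E s) + of_nat (g r) * E r)"
      by (simp only: inner sum_constant card_lessThan)
    also have "\<dots> = (\<Sum>s<r. (of_nat (g s) - of_nat (g (Suc s))) * (of_nat \<beta> * E s))
        + of_nat (g r) * (of_nat \<beta> * E r)"
      by (simp only: distrib_left sum_distrib_left mult.left_commute)
    finally show ?thesis
      by (simp only: num_edges_def \<beta>E g_def flip: \<beta> \<beta>')
  qed
  show ?thesis
  proof (intro conjI impI)
    assume "(of_nat (\<alpha> r) / of_nat \<beta> :: rat) \<ge> of_nat (\<alpha>' r) / of_nat \<beta>'"
    then show "num_edges q q' =
        (\<Sum>j<r. (of_nat (gcd_upto \<alpha>' \<beta>' j) - of_nat (gcd_upto \<alpha>' \<beta>' (Suc j))) * of_nat (\<alpha> j))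
        + of_nat (gcd_upto \<alpha>' \<beta>' r) * of_nat (\<alpha> r) - of_nat \<beta> * of_nat \<beta>'"
      using part1 by (simp only: E_def E'_def)
  next
    \<comment> \<open>Here the sum is empty and the remaining gcd is
      \<open>\<beta>'\<close>.\<close>
    assume "r = 0 \<and> (of_nat (\<alpha> 0) / of_nat \<beta> :: rat) \<ge> of_nat (\<alpha>' 0) / of_nat \<beta>'"
    then show "num_edges q q' = of_nat \<beta>' * (of_nat (\<alpha> 0) - of_nat \<beta>)"
      using part1 by (simp add: E_def E'_def gcd_upto_0 algebra_simps)
  qed
qed

end
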